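(* For every graph $G$ and every integer $l \ge 5$, $$FZ(ILAT_l(G)) \ge |V(ILAT_l(G))| - 6.$$
   Context: Graphs are finite, simple, undirected and have at least one vertex. For a vertex $v$ of a graph $G$, $N(v)$ is its neighborhood and $N[v]=N(v)\cup\{v\}$. A new vertex $v'$ added to $G$ is an anticlone of $v\in V(G)$ if $N(v')=V(G)\setminus N[v]$. The ILAT graphs with base graph $G$ are defined by $ILAT_0(G)=G$; $ILAT_1(G)$ is the graph obtained from $G$ by simultaneously adding exactly one anticlone of every vertex of $G$ (the new vertices are pairwise non-adjacent); and $ILAT_l(G)=ILAT_1(ILAT_{l-1}(G))$. Zero forcing on a graph $G$: start with a set $S\subseteq V(G)$ of forced vertices, the remaining vertices being unforced. At each time step, any forced vertex with exactly one unforced neighbor $u$ causes $u$ to become forced. $S$ is a zero forcing set if by iterating this process every vertex eventually becomes forced, and a failed zero forcing set otherwise. $FZ(G)$, the failed zero forcing number, is the maximum cardinality of a failed zero forcing set of $G$. *)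

theory Defs
  imports Main "Graph_Theory.Pair_Digraph"
begin

text \<open>
  A finite simple undirected graph is a \<open>pair_graph\<close>: finitely many vertices, no loops, and
  a symmetric set of arcs, each undirected edge being represented by its two orientations.
\<close>

definition nbhd :: "'a pair_pre_digraph \<Rightarrow> 'a \<Rightarrow> 'a set" where
  "nbhd G v = {u. (v, u) \<in> parcs G}"

definition closed_nbhd :: "'a pair_pre_digraph \<Rightarrow> 'a \<Rightarrow> 'a set" where
  "closed_nbhd G v = insert v (nbhd G v)"


section \<open>ILAT graphs\<close>

text \<open>
  \<open>add_anticlones c G\<close> simultaneously adds one anticlone of every vertex \<open>v\<close> of \<open>G\<close>; the
  function \<open>c\<close> provides the name \<open>c v\<close> of the anticlone of \<open>v\<close>. It is meant to be used with
  \<open>c\<close> injective and \<open>c v\<close> never a vertex of \<open>G\<close>.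
\<close>

definition add_anticlones :: "('a \<Rightarrow> 'a) \<Rightarrow> 'a pair_pre_digraph \<Rightarrow> 'a pair_pre_digraph" where
  "add_anticlones c G =
     \<lparr> pverts = pverts G \<union> c ` pverts G,
       parcs = parcs G
         \<union> {(c v, u) | v u. v \<in> pverts G \<and> u \<in> pverts G - closed_nbhd G v}
         \<union> {(u, c v) | v u. v \<in> pverts G \<and> u \<in> pverts G - closed_nbhd G v} \<rparr>"

text \<open>
  \<open>Anticlone l v\<close> is the vertex added as anticlone of \<open>v\<close> in the step from
  \<open>ILAT l G\<close> to \<open>ILAT (Suc l) G\<close>. The step number is needed because \<open>v\<close> receives a new anticlone
  in every later step. \<open>ILAT 0 G\<close> is \<open>G\<close> itself up to the embedding \<open>Base\<close> of its
  vertices into this type.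
\<close>

datatype 'a ilat_vertex = Base 'a | Anticlone nat "'a ilat_vertex"

primrec ILAT :: "nat \<Rightarrow> 'a pair_pre_digraph \<Rightarrow> 'a ilat_vertex pair_pre_digraph" where
  "ILAT 0 G = \<lparr> pverts = Base ` pverts G, parcs = map_prod Base Base ` parcs G \<rparr>"
| "ILAT (Suc l) G = add_anticlones (Anticlone l) (ILAT l G)"

lemma Anticlone_notin_ILAT: "l \<le> k \<Longrightarrow> Anticlone k v \<notin> pverts (ILAT l G)"
  by (induction l arbitrary: v) (auto simp: add_anticlones_def)

lemma pair_graph_add_anticlones:
  assumes "pair_graph G" and "inj c" and fresh: "\<And>v. c v \<notin> pverts G"
  shows "pair_graph (add_anticlones c G)"
proof -
  interpret pair_graph G by fact
  have "parcs (add_anticlones c G) \<subseteq> (pverts G \<union> c ` pverts G) \<times> (pverts G \<union> c ` pverts G)"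
    by (auto simp: add_anticlones_def dest: wellformed')
  moreover have "finite ((pverts G \<union> c ` pverts G) \<times> (pverts G \<union> c ` pverts G))"
    by (simp add: pair_finite_verts)
  ultimately have fin: "finite (parcs (add_anticlones c G))"
    by (rule finite_subset)
  have sym: "(u, v) \<in> parcs G \<Longrightarrow> (v, u) \<in> parcs G" for u v
    using pair_sym_arcs by (auto simp: symmetric_def dest: symD)
  show ?thesis
  proof
    show "symmetric (add_anticlones c G)"
      by (auto simp: symmetric_def add_anticlones_def intro!: symI dest: sym)
  next
    fix e assume "e \<in> parcs (add_anticlones c G)"
    then show "fst e \<noteq> snd e"
      using fresh pair_no_loops by (auto simp: add_anticlones_def)
  qed (use fin in \<open>auto simp: add_anticlones_def pair_finite_verts dest: wellformed'\<close>)
qed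

lemma pair_graph_ILAT:
  assumes "pair_graph G"
  shows "pair_graph (ILAT l G)"
proof (induction l)
  case 0
  interpret pair_graph G by fact
  have sym: "(u, v) \<in> parcs G \<Longrightarrow> (v, u) \<in> parcs G" for u v
    using pair_sym_arcs by (auto simp: symmetric_def dest: symD)
  show ?case
  proof
    show "symmetric (ILAT 0 G)"
      by (force simp: symmetric_def intro!: symI dest: sym)
  qed (auto simp: pair_finite_verts pair_finite_arcs dest: wellformed' pair_no_loops)
next
  case (Suc l)
  then show ?case
    by (auto intro!: pair_graph_add_anticlones injI simp: Anticlone_notin_ILAT)
qed

lemma nbhd_Anticlone:
  assumes "pair_graph G" and v: "v \<in> pverts (ILAT l G)"
  shows "nbhd (ILAT (Suc l) G) (Anticlone l v) = pverts (ILAT l G) - closed_nbhd (ILAT l G) v"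
proof -
  interpret H: pair_graph "ILAT l G" using assms(1) by (rule pair_graph_ILAT)
  show ?thesis
    using v Anticlone_notin_ILAT[of l l _ G]
    by (auto simp: nbhd_def add_anticlones_def dest: H.wellformed')
qed


section \<open>Zero forcing\<close>

text \<open>One time step: \<open>S\<close> is the set of currently forced vertices.\<close>

definition force_step :: "'a pair_pre_digraph \<Rightarrow> 'a set \<Rightarrow> 'a set" where
  "force_step G S = S \<union> {u. \<exists>v\<in>S. nbhd G v - S = {u}}"

definition zero_forcing_set :: "'a pair_pre_digraph \<Rightarrow> 'a set \<Rightarrow> bool" where
  "zero_forcing_set G S \<longleftrightarrow> S \<subseteq> pverts G \<and> (\<exists>t. (force_step G ^^ t) S = pverts G)"

definition failed_zero_forcing_set :: "'a pair_pre_digraph \<Rightarrow> 'a set \<Rightarrow> bool" where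
  "failed_zero_forcing_set G S \<longleftrightarrow> S \<subseteq> pverts G \<and> \<not> zero_forcing_set G S"

definition FZ :: "'a pair_pre_digraph \<Rightarrow> nat" where
  "FZ G = Max (card ` {S. failed_zero_forcing_set G S})"

text \<open>The maximum is over a finite nonempty set as soon as \<open>G\<close> has a vertex.\<close>

lemma finite_failed_zero_forcing_sets:
  "finite (pverts G) \<Longrightarrow> finite {S. failed_zero_forcing_set G S}"
  by (rule finite_subset[of _ "Pow (pverts G)"]) (auto simp: failed_zero_forcing_set_def)

lemma failed_zero_forcing_set_empty:
  assumes "pverts G \<noteq> {}"
  shows "failed_zero_forcing_set G {}"
proof -
  have "(force_step G ^^ t) {} = {}" for t
    by (induction t) (simp_all add: force_step_def)
  then show ?thesis
    using assms by (simp add: failed_zero_forcing_set_def zero_forcing_set_def)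
qed

end

theory Submission
  imports Defs
begin

text \<open>
  A nonempty set \<open>F\<close> of vertices such that no outside vertex has exactly one neighbour in \<open>F\<close> (a fort) can
  never be entered by forcing, so the complement of a fort is a failed zero forcing set.
  It is therefore enough to find a small fort, and the construction below gives one with only
  four vertices.

  Forts come from anticlones. Let \<open>F\<close> consist of the anticlones, all added in the last step, of the
  vertices in a set \<open>X\<close>. The other vertices of the last step have no neighbour in \<open>F\<close>, and an older
  vertex \<open>y\<close> is adjacent to the anticlone of \<open>x\<close> precisely when \<open>y\<close> avoids \<open>x\<close>, that is, when
  \<open>y\<close> lies outside the closed neighbourhood of \<open>x\<close>. So \<open>F\<close> is a fort as soon as every older
  vertex avoids at least two members of \<open>X\<close> (\<open>fort_of_anticlones\<close>).

  Such an \<open>X\<close> exists whenever one anticlone step has just been applied to a graph with two distinct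
  vertices \<open>u\<close> and \<open>v\<close>: take \<open>u\<close>, \<open>v\<close> and their anticlones (\<open>avoids_two_of_doubled_pair\<close>). By the
  definition of an anticlone, an old vertex avoids one of \<open>u\<close> and its anticlone, and likewise for
  \<open>v\<close>; a new vertex avoids all other new vertices and the vertex of which it is the anticlone.
  Three steps produce this situation from any nonempty graph: the first makes two vertices
  available, and the other two are the steps just described.
\<close>

definition fort :: "'a pair_pre_digraph \<Rightarrow> 'a set \<Rightarrow> bool" where
  "fort G F \<longleftrightarrow> F \<noteq> {} \<and> F \<subseteq> pverts G \<and> (\<forall>v \<in> pverts G - F. card (nbhd G v \<inter> F) \<noteq> 1)"

text \<open>
  The complement of a fort is a fixed point of the forcing process: the unforced neighbours of a
  forced vertex \<open>v\<close> are the neighbours of \<open>v\<close> in the fort, and these never form a singleton.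
\<close>

lemma failed_zero_forcing_set_fort_complement:
  assumes "pair_wf_digraph G" and F: "fort G F"
  shows "failed_zero_forcing_set G (pverts G - F)"
proof -
  interpret pair_wf_digraph G by fact
  let ?S = "pverts G - F"
  have "nbhd G v - ?S = nbhd G v \<inter> F" for v
    using F by (auto simp: nbhd_def fort_def dest: wellformed')
  moreover have "nbhd G v \<inter> F \<noteq> {u}" if "v \<in> ?S" for u v
    using F that by (auto simp: fort_def card_1_singleton_iff)
  ultimately have "force_step G ?S = ?S"
    by (auto simp: force_step_def)
  then have "(force_step G ^^ t) ?S = ?S" for t
    by (induction t) simp_all
  moreover have "?S \<noteq> pverts G"
    using F by (auto simp: fort_def)
  ultimately show ?thesis
    by (simp add: failed_zero_forcing_set_def zero_forcing_set_def)
qed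

lemma FZ_ge_fort_complement:
  assumes "pair_fin_digraph G" and F: "fort G F"
  shows "int (FZ G) \<ge> int (card (pverts G)) - int (card F)"
proof -
  interpret pair_fin_digraph G by fact
  have "failed_zero_forcing_set G (pverts G - F)"
    using F by (intro failed_zero_forcing_set_fort_complement) unfold_locales
  then have "card (pverts G - F) \<le> FZ G"
    unfolding FZ_def
    by (intro Max_ge finite_imageI finite_failed_zero_forcing_sets pair_finite_verts) blast
  moreover have "card (pverts G) \<le> card (pverts G - F) + card F"
    by (metis add.commute diff_card_le_card_Diff F fort_def le_diff_conv pair_finite_verts
        rev_finite_subset)
  ultimately show ?thesis by linarith
qed

lemma fort_of_anticlones:
  assumes "pair_wf_digraph G" and inj: "inj c" and fresh: "\<And>v. c v \<notin> pverts G"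
    and X: "X \<noteq> {}" "X \<subseteq> pverts G"
    and avoids_two: "\<And>y. y \<in> pverts G \<Longrightarrow>
      \<exists>x1 \<in> X. \<exists>x2 \<in> X. x1 \<noteq> x2 \<and> y \<notin> closed_nbhd G x1 \<and> y \<notin> closed_nbhd G x2"
  shows "fort (add_anticlones c G) (c ` X)"
proof -
  interpret pair_wf_digraph G by fact
  let ?H = "add_anticlones c G"
  have "card (nbhd ?H y \<inter> c ` X) \<noteq> 1" if "y \<in> pverts ?H - c ` X" for y
  proof (cases "y \<in> pverts G")
    case True
    then obtain x1 x2 where "x1 \<in> X" "x2 \<in> X" "x1 \<noteq> x2"
      and "y \<notin> closed_nbhd G x1" "y \<notin> closed_nbhd G x2"
      using avoids_two by blast
    then have "c x1 \<in> nbhd ?H y \<inter> c ` X" "c x2 \<in> nbhd ?H y \<inter> c ` X" "c x1 \<noteq> c x2"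
      using True X inj by (auto simp: nbhd_def add_anticlones_def dest: injD)
    then show ?thesis by (metis card_1_singletonE singletonD)
  next
    case False
    \<comment> \<open>Vertices added in the same step are pairwise non-adjacent.\<close>
    then have "nbhd ?H y \<inter> c ` X = {}"
      using fresh that by (auto simp: nbhd_def add_anticlones_def dest: wellformed')
    then show ?thesis by simp
  qed
  then show ?thesis
    using X by (auto simp: fort_def add_anticlones_def)
qed

text \<open>
  Say that \<open>y\<close> avoids \<open>x\<close> if \<open>y\<close> lies outside the closed neighbourhood of \<open>x\<close>. A vertex of \<open>G\<close> is
  adjacent to the anticlone of \<open>u\<close> only if it avoids \<open>u\<close>, so it avoids one vertex out of each of
  the pairs \<open>u, c u\<close> and \<open>v, c v\<close>. For a new vertex \<open>c z\<close>, the two avoided vertices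
  are \<open>c u\<close> and \<open>c v\<close>, except that if \<open>z\<close> is \<open>u\<close> or \<open>v\<close> then \<open>c z\<close> itself has to be replaced by \<open>z\<close>.
\<close>

lemma avoids_two_of_doubled_pair:
  fixes c u v G
  defines "H \<equiv> add_anticlones c G" and "X \<equiv> {u, v, c u, c v}"
  assumes "pair_wf_digraph G" and inj: "inj c" and fresh: "\<And>v. c v \<notin> pverts G"
    and uv: "u \<in> pverts G" "v \<in> pverts G" "u \<noteq> v"
    and y: "y \<in> pverts H"
  shows "\<exists>x1 \<in> X. \<exists>x2 \<in> X. x1 \<noteq> x2 \<and> y \<notin> closed_nbhd H x1 \<and> y \<notin> closed_nbhd H x2"
proof -
  interpret pair_wf_digraph G by fact
  have ne: "u \<noteq> c v" "v \<noteq> c u" "c u \<noteq> c v"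
    using uv fresh inj by (auto dest: injD)
  show ?thesis
  proof (cases "y \<in> pverts G")
    case True
    have old: "\<exists>x' \<in> {x, c x}. y \<notin> closed_nbhd H x'" if "x \<in> pverts G" for x
      using True that fresh inj
      by (auto simp: H_def closed_nbhd_def nbhd_def add_anticlones_def
          dest: injD wellformed')
    obtain x1 x2 where "x1 \<in> {u, c u}" "y \<notin> closed_nbhd H x1"
      "x2 \<in> {v, c v}" "y \<notin> closed_nbhd H x2"
      using old uv by blast
    with ne uv show ?thesis unfolding X_def by blast
  next
    case False
    then obtain z where z: "z \<in> pverts G" "y = c z"
      using y by (auto simp: H_def add_anticlones_def)
    have new: "y \<notin> closed_nbhd H (c x)" if "x \<noteq> z" for x
      using z that fresh inj
      by (auto simp: H_def closed_nbhd_def nbhd_def add_anticlones_def dest: injD wellformed')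
    have "c z \<noteq> z"
      using z(1) fresh[of z] by metis
    moreover have "(z, c z) \<notin> parcs H"
    proof
      assume "(z, c z) \<in> parcs H"
      then consider "(z, c z) \<in> parcs G" | w where "z = c w"
        | w where "c z = c w" "z \<notin> closed_nbhd G w"
        unfolding H_def add_anticlones_def by auto
      then show False
      proof cases
        case 1
        then show ?thesis using wellformed'(2) fresh by blast
      next
        case 2
        then show ?thesis using z(1) fresh by blast
      next
        case 3
        then show ?thesis using inj by (simp add: inj_eq closed_nbhd_def)
      qed
    qed
    ultimately have self: "y \<notin> closed_nbhd H z"
      using z(2) by (simp add: closed_nbhd_def nbhd_def)
    consider "z = u" | "z = v" | "z \<noteq> u" "z \<noteq> v" by blast
    then show ?thesis
    proof cases
      case 1
      have "u \<noteq> c v" "y \<notin> closed_nbhd H u" "y \<notin> closed_nbhd H (c v)"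
        using 1 ne(1) self new[of v] uv(3) by simp_all
      then show ?thesis unfolding X_def by blast
    next
      case 2
      have "v \<noteq> c u" "y \<notin> closed_nbhd H v" "y \<notin> closed_nbhd H (c u)"
        using 2 ne(2) self new[of u] uv(3) by simp_all
      then show ?thesis unfolding X_def by blast
    next
      case 3
      have "y \<notin> closed_nbhd H (c u)" "y \<notin> closed_nbhd H (c v)"
        using 3 new by simp_all
      with ne(3) show ?thesis unfolding X_def by blast
    qed
  qed
qed

lemma ILAT_Suc_two_vertices:
  assumes "pverts G \<noteq> {}"
  obtains u v where "u \<in> pverts (ILAT (Suc l) G)" "v \<in> pverts (ILAT (Suc l) G)" "u \<noteq> v"
proof -
  have "pverts (ILAT l G) \<noteq> {}"
    using assms by (induction l) (auto simp: add_anticlones_def)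
  then obtain u where "u \<in> pverts (ILAT l G)" by blast
  with Anticlone_notin_ILAT[of l l u G] that[of u "Anticlone l u"] show ?thesis
    by (auto simp: add_anticlones_def)
qed

lemma ILAT_fort_of_size_4:
  assumes "pair_graph G" and "pverts G \<noteq> {}"
  obtains F where "fort (ILAT (Suc (Suc (Suc k))) G) F" and "card F = 4"
proof -
  let ?H = "ILAT (Suc k) G" and ?c = "Anticlone (Suc k)" and ?d = "Anticlone (Suc (Suc k))"
  let ?K = "ILAT (Suc (Suc k)) G"
  interpret H: pair_graph ?H using assms(1) by (rule pair_graph_ILAT)
  interpret K: pair_graph ?K using assms(1) by (rule pair_graph_ILAT)
  obtain u v where uv: "u \<in> pverts ?H" "v \<in> pverts ?H" "u \<noteq> v"
    using ILAT_Suc_two_vertices[OF assms(2)] by blast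
  define X where "X = {u, v, ?c u, ?c v}"
  have fresh_c: "?c w \<notin> pverts ?H" for w
    by (rule Anticlone_notin_ILAT) simp
  have fresh_d: "?d w \<notin> pverts ?K" for w
    by (rule Anticlone_notin_ILAT) simp
  have inj: "inj ?c" "inj ?d"
    by (auto intro: injI)
  have K: "?K = add_anticlones ?c ?H"
    by (rule ILAT.simps)
  have X: "X \<noteq> {}" "X \<subseteq> pverts ?K"
    unfolding X_def K using uv by (auto simp only: add_anticlones_def pair_pre_digraph.simps)
  have "fort (add_anticlones ?d ?K) (?d ` X)"
  proof (rule fort_of_anticlones[OF K.pair_wf_digraph_axioms inj(2) fresh_d X])
    fix y assume "y \<in> pverts ?K"
    then show "\<exists>x1 \<in> X. \<exists>x2 \<in> X. x1 \<noteq> x2 \<and> y \<notin> closed_nbhd ?K x1 \<and> y \<notin> closed_nbhd ?K x2"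
      unfolding X_def K
      by (rule avoids_two_of_doubled_pair[OF H.pair_wf_digraph_axioms inj(1) fresh_c uv])
  qed
  then have "fort (ILAT (Suc (Suc (Suc k))) G) (?d ` X)"
    by (subst ILAT.simps)
  moreover have "card X = 4"
  proof -
    have "u \<noteq> ?c u" "u \<noteq> ?c v" "v \<noteq> ?c u" "v \<noteq> ?c v"
      using uv fresh_c by metis+
    then show ?thesis using uv(3) by (simp add: X_def)
  qed
  then have "card (?d ` X) = 4"
    using inj(2) by (metis card_image inj_on_subset subset_UNIV)
  ultimately show ?thesis by (rule that)
qed

theorem theorem3p1:
  fixes G :: "'a pair_pre_digraph" and l :: nat
  assumes "pair_graph G" and "pverts G \<noteq> {}" and "l \<ge> 5"
  shows "int (FZ (ILAT l G)) \<ge> int (card (pverts (ILAT l G))) - 6"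
proof -
  obtain k where l: "l = Suc (Suc (Suc k))"
    using assms(3) that[of "l - 3"] by simp
  interpret pair_graph "ILAT l G" using assms(1) by (rule pair_graph_ILAT)
  obtain F where "fort (ILAT l G) F" "card F = 4"
    using ILAT_fort_of_size_4[OF assms(1,2)] l by blast
  then show ?thesis
    using FZ_ge_fort_complement[of "ILAT l G" F] pair_fin_digraph_axioms by simp
qed

end
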